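(* Let $\mathbb{D}$ be the open unit disc in $\mathbb{C}$ and let $H(\mathbb{D})$ be the Fréchet space of all analytic functions on $\mathbb{D}$, equipped with the compact-open topology. Then $H(\mathbb{D})$ supports no strongly supercyclic weighted composition operator; that is, for all $w,\phi\in H(\mathbb{D})$ with $\phi(\mathbb{D})\subseteq\mathbb{D}$, the weighted composition operator $C_{w,\phi}: H(\mathbb{D})\to H(\mathbb{D})$, $C_{w,\phi}(f)=w\cdot(f\circ\phi)$, is not strongly supercyclic.
   Context: For $w,\phi\in H(\mathbb{D})$ with $\phi(\mathbb{D})\subseteq\mathbb{D}$, the weighted composition operator $C_{w,\phi}$ on $H(\mathbb{D})$ is the continuous linear operator defined by $C_{w,\phi}(f)(z)=w(z)f(\phi(z))$ for $f\in H(\mathbb{D})$, $z\in\mathbb{D}$. Let $\mathbb{N}_0$ denote the set of non-negative integers. A continuous linear operator $T$ on an infinite-dimensional second countable Baire topological vector space $\mathcal{X}$ over $\mathbb{C}$ is called strongly supercyclic if for every nonempty open subset $U$ of $\mathcal{X}$, $$\mathcal{X}\setminus\{0\}\subseteq\bigcup_{b\in\mathbb{C},\,n\in\mathbb{N}_0} bT^n(U),$$ where $T^0=I$ is the identity operator and $bT^n(U)=\{bT^n u: u\in U\}$. *)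

theory Defs
  imports "HOL-Complex_Analysis.Complex_Analysis" "HOL-Library.Function_Algebras"
begin

abbreviation unit_disc :: "complex set" where
  "unit_disc \<equiv> ball 0 1"

text \<open>
  An element of \<open>H(\<D>)\<close> is represented by its extension by \<open>0\<close> to all of \<open>\<complex>\<close>.  This makes the
  representation unique and turns \<open>H(\<D>)\<close> into a linear subspace of \<open>complex \<Rightarrow> complex\<close> with the
  pointwise operations; in particular its zero vector is the constant function \<open>0\<close>.
\<close>

definition hol_disc :: "(complex \<Rightarrow> complex) set" where
  "hol_disc = {f. f holomorphic_on unit_disc \<and> (\<forall>z. z \<notin> unit_disc \<longrightarrow> f z = 0)}"

definition fun_scale :: "complex \<Rightarrow> (complex \<Rightarrow> complex) \<Rightarrow> (complex \<Rightarrow> complex)" where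
  "fun_scale b f = (\<lambda>z. b * f z)"

definition compact_open_disc :: "(complex \<Rightarrow> complex) topology" where
  "compact_open_disc = topology_generated_by
     {{f \<in> hol_disc. f ` K \<subseteq> V} | K V. compact K \<and> K \<subseteq> unit_disc \<and> open V}"

definition weighted_comp ::
    "(complex \<Rightarrow> complex) \<Rightarrow> (complex \<Rightarrow> complex) \<Rightarrow> (complex \<Rightarrow> complex) \<Rightarrow> (complex \<Rightarrow> complex)" where
  "weighted_comp w \<phi> f = (\<lambda>z. if z \<in> unit_disc then w z * f (\<phi> z) else 0)"

text \<open>
  The topological vector space is the carrier \<open>topspace X\<close> of an abstract topology \<open>X\<close>, with scalar
  multiplication \<open>scal\<close>.  The notion is meant for a continuous linear operator \<open>T\<close> on an
  infinite-dimensional second countable Baire space.  These are standing assumptions and not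
  part of the condition, so that an operator can fail to be strongly supercyclic only by failing
  the covering condition.
\<close>

definition strongly_supercyclic ::
    "'a::zero topology \<Rightarrow> (complex \<Rightarrow> 'a \<Rightarrow> 'a) \<Rightarrow> ('a \<Rightarrow> 'a) \<Rightarrow> bool" where
  "strongly_supercyclic X scal T \<longleftrightarrow>
     (\<forall>U. openin X U \<and> U \<noteq> {} \<longrightarrow>
        topspace X - {0} \<subseteq> (\<Union>b::complex. \<Union>n::nat. (\<lambda>u. scal b ((T ^^ n) u)) ` U))"

text \<open>
  \<open>H(\<D>)\<close> is a complex vector space, and the weighted composition operators are continuous
  linear operators on it.
\<close>

lemma topspace_compact_open_disc [simp]: "topspace compact_open_disc = hol_disc"
proof -
  have "{f \<in> hol_disc. f ` {} \<subseteq> UNIV} \<in>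
      {{f \<in> hol_disc. f ` K \<subseteq> V} | K V. compact K \<and> K \<subseteq> unit_disc \<and> open V}"
    by blast
  then show ?thesis
    unfolding compact_open_disc_def topology_generated_by_topspace by auto
qed

lemma vector_space_fun_scale: "vector_space fun_scale"
  by standard (auto simp: fun_scale_def fun_eq_iff algebra_simps)

lemma subspace_hol_disc: "module.subspace fun_scale hol_disc"
proof -
  interpret vector_space fun_scale by (rule vector_space_fun_scale)
  show ?thesis
    unfolding subspace_def
    by (auto simp: hol_disc_def fun_scale_def zero_fun_def plus_fun_def intro!: holomorphic_intros)
qed

lemma linear_weighted_comp: "Vector_Spaces.linear fun_scale fun_scale (weighted_comp w \<phi>)"
proof -
  interpret vector_space fun_scale by (rule vector_space_fun_scale)
  show ?thesis
    by unfold_locales (auto simp: weighted_comp_def fun_scale_def fun_eq_iff algebra_simps)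
qed

lemma weighted_comp_in_hol_disc:
  assumes "w holomorphic_on unit_disc" "\<phi> holomorphic_on unit_disc" "\<phi> ` unit_disc \<subseteq> unit_disc"
    and "f \<in> hol_disc"
  shows "weighted_comp w \<phi> f \<in> hol_disc"
proof -
  have "(\<lambda>z. w z * (f \<circ> \<phi>) z) holomorphic_on unit_disc"
    using assms by (intro holomorphic_intros holomorphic_on_compose_gen) (auto simp: hol_disc_def)
  then have "weighted_comp w \<phi> f holomorphic_on unit_disc"
    by (rule holomorphic_transform) (auto simp: weighted_comp_def)
  then show ?thesis
    by (auto simp: hol_disc_def weighted_comp_def)
qed

lemma openin_compact_open_disc_subbasis:
  assumes "compact K" "K \<subseteq> unit_disc" "open V"
  shows "openin compact_open_disc {f \<in> hol_disc. f ` K \<subseteq> V}"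
  unfolding compact_open_disc_def by (rule topology_generated_by_Basis) (use assms in blast)

lemma compact_open_disc_uniform_nhd:
  assumes f0: "f0 \<in> hol_disc" and L: "compact L" "L \<subseteq> unit_disc" and e: "e > 0"
  obtains N where "openin compact_open_disc N" "f0 \<in> N" "\<And>f z. f \<in> N \<Longrightarrow> z \<in> L \<Longrightarrow> dist (f z) (f0 z) < e"
proof -
  have cont: "continuous_on L f0"
    using f0 L(2) by (auto simp: hol_disc_def intro: holomorphic_on_imp_continuous_on holomorphic_on_subset)
  have "uniformly_continuous_on L f0"
    using compact_uniformly_continuous[OF cont L(1)] .
  then obtain d where d: "d > 0"
    "\<And>x y. x \<in> L \<Longrightarrow> y \<in> L \<Longrightarrow> dist y x < d \<Longrightarrow> dist (f0 y) (f0 x) < e/2"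
    using e unfolding uniformly_continuous_on_def by (meson half_gt_zero)
  obtain F where F: "F \<subseteq> L" "finite F" "L \<subseteq> (\<Union>x\<in>F. ball x (d/2))"
    using compactE_image[OF L(1), of L "\<lambda>x. ball x (d/2)"] d(1)
    by (metis (no_types, lifting) UN_I centre_in_ball half_gt_zero open_ball subsetI)
  define A where "A x = {f \<in> hol_disc. f ` (L \<inter> cball x (d/2)) \<subseteq> ball (f0 x) (e/2)}" for x
  define N where "N = hol_disc \<inter> \<Inter> (A ` F)"
  have "openin compact_open_disc (A x)" for x
    unfolding A_def using L by (intro openin_compact_open_disc_subbasis compact_Int_closed) auto
  then have "openin compact_open_disc N"
    using F(2) unfolding N_def
    by (cases "F = {}") (auto intro!: openin_Int openin_Inter openin_topspace[of compact_open_disc, simplified])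
  moreover have "f0 \<in> N"
  proof -
    have "f0 y \<in> ball (f0 x) (e/2)" if "x \<in> F" "y \<in> L" "y \<in> cball x (d/2)" for x y
      using d(2)[of x y] that F(1) d(1) by (auto simp: dist_commute)
    then show ?thesis using f0 by (auto simp: N_def A_def)
  qed
  moreover have "dist (f z) (f0 z) < e" if f: "f \<in> N" and z: "z \<in> L" for f z
  proof -
    obtain x where x: "x \<in> F" "z \<in> ball x (d/2)" using F(3) z by auto
    have "dist (f0 x) (f z) < e/2"
      using f x z by (force simp: N_def A_def)
    moreover have "dist (f0 z) (f0 x) < e/2"
      using d(2)[of x z] x F(1) z d(1) by (auto simp: dist_commute)
    ultimately show ?thesis
      using dist_triangle_half_l[of "f z" "f0 x" e "f0 z"] by (simp add: dist_commute)
  qed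
  ultimately show ?thesis by (rule that)
qed

lemma continuous_map_weighted_comp:
  assumes w: "w holomorphic_on unit_disc" and \<phi>: "\<phi> holomorphic_on unit_disc" "\<phi> ` unit_disc \<subseteq> unit_disc"
  shows "continuous_map compact_open_disc compact_open_disc (weighted_comp w \<phi>)"
proof -
  let ?C = "weighted_comp w \<phi>"
  have "openin compact_open_disc (?C -` {f \<in> hol_disc. f ` K \<subseteq> V} \<inter> hol_disc)"
    if K: "compact K" "K \<subseteq> unit_disc" and V: "open V" for K V
  proof (subst openin_subopen, intro ballI)
    fix f0 assume "f0 \<in> ?C -` {f \<in> hol_disc. f ` K \<subseteq> V} \<inter> hol_disc"
    then have f0: "f0 \<in> hol_disc" "?C f0 \<in> hol_disc" "?C f0 ` K \<subseteq> V" by auto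
    have "continuous_on K (?C f0)"
      using f0(2) K(2) by (auto simp: hol_disc_def intro: holomorphic_on_imp_continuous_on holomorphic_on_subset)
    then have "compact (?C f0 ` K)" using K(1) by (rule compact_continuous_image)
    then obtain e where e: "e > 0" "(\<Union>x\<in>?C f0 ` K. ball x e) \<subseteq> V"
      using compact_subset_open_imp_ball_epsilon_subset[OF _ V f0(3)] by metis
    have cw: "continuous_on K w" "continuous_on K \<phi>"
      using w \<phi>(1) K(2) by (auto intro: holomorphic_on_imp_continuous_on holomorphic_on_subset)
    have "bounded (w ` K)" using cw(1) K(1) by (intro compact_imp_bounded compact_continuous_image)
    then obtain M where M: "M > 0" "\<And>z. z \<in> K \<Longrightarrow> norm (w z) \<le> M"
      unfolding bounded_pos by auto
    have "compact (\<phi> ` K)" "\<phi> ` K \<subseteq> unit_disc"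
      using cw(2) K \<phi>(2) by (auto intro: compact_continuous_image)
    then obtain N where N: "openin compact_open_disc N" "f0 \<in> N"
      "\<And>f z. f \<in> N \<Longrightarrow> z \<in> \<phi> ` K \<Longrightarrow> dist (f z) (f0 z) < e / M"
      using compact_open_disc_uniform_nhd[OF f0(1), of "\<phi> ` K" "e / M"] e(1) M(1) by auto
    have "?C f z \<in> V" if f: "f \<in> N" and z: "z \<in> K" for f z
    proof -
      have zD: "z \<in> unit_disc" using z K(2) by auto
      have "dist (?C f z) (?C f0 z) = norm (w z) * dist (f (\<phi> z)) (f0 (\<phi> z))"
        using zD by (auto simp: weighted_comp_def dist_norm norm_mult simp flip: right_diff_distrib)
      also have "\<dots> \<le> M * dist (f (\<phi> z)) (f0 (\<phi> z))"
        by (intro mult_right_mono M z) auto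
      also have "\<dots> < e"
        using N(3)[OF f, of "\<phi> z"] z M(1) by (auto simp: field_simps)
      finally have "?C f z \<in> ball (?C f0 z) e" by (simp add: dist_commute)
      then show ?thesis using e(2) z by blast
    qed
    moreover have "N \<subseteq> hol_disc" using openin_subset[OF N(1)] by simp
    ultimately have "N \<subseteq> ?C -` {f \<in> hol_disc. f ` K \<subseteq> V} \<inter> hol_disc"
      using weighted_comp_in_hol_disc[OF w \<phi>] by auto
    then show "\<exists>T. openin compact_open_disc T \<and> f0 \<in> T \<and>
        T \<subseteq> ?C -` {f \<in> hol_disc. f ` K \<subseteq> V} \<inter> hol_disc"
      using N by blast
  qed
  then have "continuous_map compact_open_disc (topology_generated_by
     {{f \<in> hol_disc. f ` K \<subseteq> V} | K V. compact K \<and> K \<subseteq> unit_disc \<and> open V}) ?C"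
    unfolding continuous_on_generated_topo_iff
    using weighted_comp_in_hol_disc[OF w \<phi>] 
      topspace_compact_open_disc[unfolded compact_open_disc_def topology_generated_by_topspace]
    by auto
  then show ?thesis by (simp flip: compact_open_disc_def)
qed

end

theory Submission
  imports Defs
begin

text \<open>
  The proof assumes strong supercyclicity of \<open>T = C\<^bsub>w,\<phi>\<^esub>\<close> and first extracts rigidity.  A nonzero
  function outside the range of \<open>T\<close> could only be reached with \<open>n = 0\<close>, that is, its complex
  line would meet every nonempty open set, which is absurd; so \<open>T\<close> is onto
  (\<open>strongly_supercyclic_imp_onto\<close>).  Solving \<open>w \<cdot> (f \<circ> \<phi>) = g\<close> for \<open>g = 1\<close>, \<open>g = w \<cdot> id\<close> and
  \<open>g = w / (\<phi> - p)\<close> with \<open>p\<close> outside the range of \<open>\<phi>\<close> shows in turn that \<open>w\<close> has no zeros, that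
  \<open>\<phi>\<close> is injective, and that \<open>\<phi>\<close> is onto.  Hence \<open>\<phi>\<close> is an automorphism of the disc, and by the
  Schwarz lemma a Moebius map.

  The contradiction then comes from a single nonzero function \<open>g\<close> whose zero set \<open>Z\<close> is nonempty
  and contains the preimage \<open>\<phi>\<^sup>-\<^sup>1(Z)\<close> (\<open>not_strongly_supercyclic_of_zeros\<close>).  Take \<open>U\<close> to be the
  functions not vanishing at some \<open>a \<in> Z\<close>.  For \<open>u \<in> U\<close>, the function \<open>T\<^sup>n u\<close> does not vanish at the
  point \<open>z\<close> with \<open>\<phi>\<^sup>n(z) = a\<close>, whereas \<open>g\<close> does; so \<open>g\<close> is not a multiple of \<open>T\<^sup>n u\<close>.

  To find \<open>g\<close>, look at the fixed points of the Moebius map.  If there is one in the disc, say \<open>p\<close>,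
  take \<open>g(z) = z - p\<close>.  Otherwise let \<open>p\<close> be a fixed point outside the disc.  In the coordinate
  \<open>1/(p - z)\<close> the map \<open>\<phi>\<close> is affine.  This coordinate (when the affine map is a translation) or the
  logarithm of its difference from the finite fixed point of the affine map solves the Abel equation
  \<open>h \<circ> \<phi> = h + \<kappa>\<close> with \<open>\<kappa> \<noteq> 0\<close> (\<open>fixed_point_free_moebius_abel\<close>).  Then \<open>exp (2\<pi>\<i>h/\<kappa>)\<close>
  is \<open>\<phi>\<close>-invariant and not constant, and subtracting its value at \<open>0\<close> gives \<open>g\<close>.
\<close>

section \<open>Surjectivity of a strongly supercyclic operator\<close>

lemma hol_disc_restrict:
  assumes "f holomorphic_on unit_disc"
  shows "(\<lambda>z. if z \<in> unit_disc then f z else 0) \<in> hol_disc"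
proof -
  have "(\<lambda>z. if z \<in> unit_disc then f z else 0) holomorphic_on unit_disc"
    using assms by (rule holomorphic_transform) auto
  then show ?thesis by (auto simp: hol_disc_def)
qed

lemma openin_compact_open_disc_eval:
  assumes "a \<in> unit_disc" "open V"
  shows "openin compact_open_disc {f \<in> hol_disc. f a \<in> V}"
  using openin_compact_open_disc_subbasis[of "{a}" V] assms by auto

lemma weighted_comp_iterate_in_hol_disc:
  assumes "w holomorphic_on unit_disc" "\<phi> holomorphic_on unit_disc" "\<phi> ` unit_disc \<subseteq> unit_disc"
    and "u \<in> hol_disc"
  shows "(weighted_comp w \<phi> ^^ n) u \<in> hol_disc"
  using assms(4) by (induction n) (auto intro: weighted_comp_in_hol_disc[OF assms(1-3)])

lemma strongly_supercyclicE:
  assumes "strongly_supercyclic compact_open_disc fun_scale T"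
    and "openin compact_open_disc U" "U \<noteq> {}" "g \<in> hol_disc" "g \<noteq> 0"
  obtains b n u where "u \<in> U" "g = fun_scale b ((T ^^ n) u)"
proof -
  have "g \<in> (\<Union>b. \<Union>n. (\<lambda>u. fun_scale b ((T ^^ n) u)) ` U)"
    using assms unfolding strongly_supercyclic_def topspace_compact_open_disc by blast
  then show ?thesis using that by blast
qed

text \<open>
  The two open sets given by \<open>|f x| < 1 < |f y|\<close> and by \<open>|f y| < 1 < |f x|\<close> cannot both meet
  the complex line spanned by \<open>g\<close>.  So one of them reaches \<open>g\<close> only with a positive power of \<open>T\<close>.
\<close>

lemma strongly_supercyclic_imp_onto:
  assumes ssc: "strongly_supercyclic compact_open_disc fun_scale (weighted_comp w \<phi>)"
    and w: "w holomorphic_on unit_disc" and \<phi>: "\<phi> holomorphic_on unit_disc" "\<phi> ` unit_disc \<subseteq> unit_disc"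
    and g: "g holomorphic_on unit_disc"
  obtains f where "f \<in> hol_disc" "\<And>z. z \<in> unit_disc \<Longrightarrow> w z * f (\<phi> z) = g z"
proof -
  define T where "T = weighted_comp w \<phi>"
  define G where "G = (\<lambda>z. if z \<in> unit_disc then g z else 0)"
  have G: "G \<in> hol_disc"
    unfolding G_def by (rule hol_disc_restrict[OF g])
  have "\<exists>f\<in>hol_disc. T f = G"
  proof (rule ccontr)
    assume nex: "\<not> (\<exists>f\<in>hol_disc. T f = G)"
    have "T 0 = 0" "0 \<in> hol_disc"
      by (auto simp: T_def weighted_comp_def fun_eq_iff hol_disc_def zero_fun_def)
    then have "G \<noteq> 0" using nex by metis
    have less: "norm (G x) < norm (G y)"
      if xy: "x \<in> unit_disc" "y \<in> unit_disc" "x \<noteq> y" for x y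
    proof -
      define U where "U = {f \<in> hol_disc. f x \<in> ball 0 1} \<inter> {f \<in> hol_disc. f y \<in> - cball 0 1}"
      have U_open: "openin compact_open_disc U"
        unfolding U_def using xy by (intro openin_Int openin_compact_open_disc_eval) auto
      have "(\<lambda>z. if z \<in> unit_disc then 2 * ((z - x) / (y - x)) else 0) \<in> U"
      proof -
        have "(\<lambda>z. 2 * ((z - x) / (y - x))) holomorphic_on unit_disc"
          using xy by (intro holomorphic_intros) auto
        from hol_disc_restrict[OF this] show ?thesis using xy by (simp add: U_def)
      qed
      then have "U \<noteq> {}" by blast
      obtain b n u where u: "u \<in> U" and Gu: "G = fun_scale b ((T ^^ n) u)"
        by (rule strongly_supercyclicE[OF ssc[folded T_def] U_open \<open>U \<noteq> {}\<close> G \<open>G \<noteq> 0\<close>])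
      have "u \<in> hol_disc" using u by (simp add: U_def)
      have "b \<noteq> 0" using Gu \<open>G \<noteq> 0\<close> by (auto simp: fun_scale_def fun_eq_iff)
      have "n = 0"
      proof (rule ccontr)
        assume "n \<noteq> 0"
        then obtain m where m: "n = Suc m" using not0_implies_Suc by blast
        define v where "v = (T ^^ m) u"
        have v: "v \<in> hol_disc"
          unfolding v_def T_def
          by (rule weighted_comp_iterate_in_hol_disc[OF w \<phi> \<open>u \<in> hol_disc\<close>])
        have "fun_scale b v \<in> hol_disc"
          using v by (auto simp: hol_disc_def fun_scale_def intro!: holomorphic_intros)
        moreover have "T (fun_scale b v) = G"
        proof -
          have "T (fun_scale b v) = fun_scale b (T v)"
            by (simp add: T_def weighted_comp_def fun_scale_def fun_eq_iff)
          also have "T v = (T ^^ n) u" by (simp add: m v_def)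
          finally show ?thesis using Gu by simp
        qed
        ultimately show False using nex by blast
      qed
      then have "G z = b * u z" for z using Gu by (simp add: fun_scale_def)
      moreover have "norm (u x) < norm (u y)" using u by (auto simp: U_def)
      ultimately show ?thesis using \<open>b \<noteq> 0\<close> by (simp add: norm_mult)
    qed
    show False using less[of 0 "1/2"] less[of "1/2" 0] by simp
  qed
  then obtain f where f: "f \<in> hol_disc" "T f = G" by blast
  have "w z * f (\<phi> z) = g z" if "z \<in> unit_disc" for z
    using fun_cong[OF f(2), of z] that by (simp add: T_def G_def weighted_comp_def)
  then show ?thesis by (rule that[OF f(1)])
qed

text \<open>
  For surjectivity of \<open>\<phi>\<close>: if \<open>p\<close> is omitted, the equation for \<open>w / (\<phi> - p)\<close> yields \<open>f\<close> with
  \<open>f(y) (y - p) = 1\<close> on the open set \<open>\<phi>(\<D>)\<close>, hence on all of \<open>\<D>\<close>, which fails at \<open>y = p\<close>.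
\<close>

lemma strongly_supercyclic_imp_automorphism:
  assumes ssc: "strongly_supercyclic compact_open_disc fun_scale (weighted_comp w \<phi>)"
    and w: "w holomorphic_on unit_disc" and \<phi>: "\<phi> holomorphic_on unit_disc" "\<phi> ` unit_disc \<subseteq> unit_disc"
  shows "\<And>z. z \<in> unit_disc \<Longrightarrow> w z \<noteq> 0" and "inj_on \<phi> unit_disc" and "\<phi> ` unit_disc = unit_disc"
proof -
  note onto = strongly_supercyclic_imp_onto[OF ssc w \<phi>]
  show nz: "w z \<noteq> 0" if "z \<in> unit_disc" for z
    using onto[of "\<lambda>_. 1"] that
    by (metis holomorphic_on_const mult_zero_left zero_neq_one)
  show inj: "inj_on \<phi> unit_disc"
  proof -
    obtain f where "\<And>z. z \<in> unit_disc \<Longrightarrow> w z * f (\<phi> z) = w z * z"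
      using onto[of "\<lambda>z. w z * z"] w by (metis holomorphic_on_ident holomorphic_on_mult)
    then have "f (\<phi> z) = z" if "z \<in> unit_disc" for z using nz that by simp
    then show ?thesis by (rule inj_on_inverseI)
  qed
  show "\<phi> ` unit_disc = unit_disc"
  proof (rule ccontr)
    assume "\<phi> ` unit_disc \<noteq> unit_disc"
    then obtain p where p: "p \<in> unit_disc" "p \<notin> \<phi> ` unit_disc" using \<phi>(2) by blast
    have ne: "\<phi> z - p \<noteq> 0" if "z \<in> unit_disc" for z using p that by auto
    then have "(\<lambda>z. w z / (\<phi> z - p)) holomorphic_on unit_disc"
      by (intro holomorphic_intros w \<phi>)
    from onto[OF this] obtain f where f: "f \<in> hol_disc"
      and eq: "\<And>z. z \<in> unit_disc \<Longrightarrow> w z * f (\<phi> z) = w z / (\<phi> z - p)"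
      by blast
    have "f y * (y - p) = 1" if y: "y \<in> \<phi> ` unit_disc" for y
    proof -
      obtain z where z: "z \<in> unit_disc" "y = \<phi> z" using y by blast
      have "w z * (f y * (y - p)) = w z"
        using eq[OF z(1)] ne[OF z(1)] z(2) by (simp flip: mult.assoc)
      then show ?thesis using nz[OF z(1)] by simp
    qed
    moreover have "open (\<phi> ` unit_disc)"
      by (rule open_mapping_thm3[OF \<phi>(1) open_ball inj])
    moreover have "(\<lambda>y. f y * (y - p)) holomorphic_on unit_disc"
      using f by (auto simp: hol_disc_def intro!: holomorphic_intros)
    moreover have "\<phi> ` unit_disc \<noteq> {}" by simp
    ultimately have "f p * (p - p) = 1"
      using analytic_continuation_open[of "\<phi> ` unit_disc" unit_disc "\<lambda>y. f y * (y - p)" "\<lambda>_. 1" p]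
        \<phi>(2) p(1) by simp
    then show False by simp
  qed
qed

section \<open>Automorphisms of the disc\<close>

text \<open>
  Composing with a Moebius map moves the zero of \<open>\<phi>\<close> to the origin; the Schwarz lemma for the
  resulting map and for its inverse makes it a rotation.
\<close>

lemma disc_automorphism_is_moebius:
  assumes hol: "\<phi> holomorphic_on unit_disc" and inj: "inj_on \<phi> unit_disc"
    and onto: "\<phi> ` unit_disc = unit_disc"
  obtains \<alpha> b where "\<alpha> \<noteq> 0" "norm b < 1"
    "\<And>z. z \<in> unit_disc \<Longrightarrow> \<phi> z = \<alpha> * (z - b) / (1 - cnj b * z)"
proof -
  have "0 \<in> \<phi> ` unit_disc" using onto by simp
  then obtain b where b: "norm b < 1" "\<phi> b = 0" by auto
  obtain \<psi> where \<psi>: "\<psi> holomorphic_on unit_disc" "\<And>z. z \<in> unit_disc \<Longrightarrow> \<psi> (\<phi> z) = z"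
    using holomorphic_has_inverse[OF hol open_ball inj] onto by metis
  have \<psi>_in: "\<psi> y \<in> unit_disc" if y: "y \<in> unit_disc" for y
  proof -
    obtain z where "z \<in> unit_disc" "y = \<phi> z" using y onto by blast
    then show ?thesis using \<psi>(2) by simp
  qed
  let ?M = "Moebius_function 0"
  have M_in: "?M c z \<in> unit_disc" if "norm c < 1" "z \<in> unit_disc" for c z
    using Moebius_function_norm_lt_1[of c z] that by simp
  have M_hol: "?M c holomorphic_on unit_disc" if "norm c < 1" for c
    using Moebius_function_holomorphic that .
  define F where "F = \<phi> \<circ> ?M (- b)"
  define G where "G = ?M b \<circ> \<psi>"
  have F_in: "F z \<in> unit_disc" if "z \<in> unit_disc" for z
    using M_in[of "- b" z] b(1) that onto by (auto simp: F_def)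
  have F_hol: "F holomorphic_on unit_disc"
    unfolding F_def using M_hol[of "- b"] M_in[of "- b"] b(1) hol
    by (intro holomorphic_on_compose_gen[where t = unit_disc]) auto
  have F_0: "F 0 = 0" using b(2) by (simp add: F_def Moebius_function_of_zero)
  have F: "norm (F z) \<le> norm z" if "z \<in> unit_disc" for z
    by (rule Schwarz_Lemma[OF F_hol F_0]) (use F_in that in auto)
  have G: "norm (G z) \<le> norm z" if "z \<in> unit_disc" for z
  proof (rule Schwarz_Lemma)
    show "G holomorphic_on unit_disc"
      unfolding G_def using M_hol[of b] \<psi>_in b(1) \<psi>(1)
      by (intro holomorphic_on_compose_gen[where t = unit_disc]) auto
    have "\<psi> 0 = b" using \<psi>(2)[of b] b by simp
    then show "G 0 = 0" by (simp add: G_def Moebius_function_eq_zero)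
  qed (use M_in[of b] b(1) \<psi>_in that in \<open>auto simp: G_def\<close>)
  have "G (F z) = z" if "z \<in> unit_disc" for z
    using \<psi>(2) M_in[of "- b" z] that b(1) Moebius_function_compose[of b "- b" z]
    by (simp add: F_def G_def)
  then have normF: "norm (F z) = norm z" if "z \<in> unit_disc" for z
    using F[OF that] G[OF F_in[OF that]] that by simp
  have "\<exists>\<alpha>. (\<forall>z. norm z < 1 \<longrightarrow> F z = \<alpha> * z) \<and> norm \<alpha> = 1"
  proof (rule Schwarz_Lemma(3)[OF F_hol F_0])
    show "(\<exists>z. norm z < 1 \<and> z \<noteq> 0 \<and> norm (F z) = norm z) \<or> norm (deriv F 0) = 1"
      using normF[of "1/2"] by (intro disjI1 exI[of _ "1/2"]) auto
    show "norm (0::complex) < 1" by simp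
  qed (use F_in in auto)
  then obtain \<alpha> where \<alpha>: "\<And>z. norm z < 1 \<Longrightarrow> F z = \<alpha> * z" "norm \<alpha> = 1" by blast
  show ?thesis
  proof
    show "\<alpha> \<noteq> 0" using \<alpha>(2) by auto
    show "norm b < 1" by fact
    fix z assume z: "z \<in> unit_disc"
    have "\<phi> z = F (?M b z)"
      using Moebius_function_compose[of "- b" b z] b(1) z by (simp add: F_def)
    also have "\<dots> = \<alpha> * ?M b z" using \<alpha>(1) M_in[of b z] b(1) z by simp
    finally show "\<phi> z = \<alpha> * (z - b) / (1 - cnj b * z)" by (simp add: Moebius_function_simple)
  qed
qed

lemma moebius_denominator_nonzero:
  fixes b z :: complex
  assumes "norm b < 1" "norm z < 1"
  shows "1 - cnj b * z \<noteq> 0"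
proof
  assume "1 - cnj b * z = 0"
  then have "norm (cnj b * z) = 1" by (metis norm_one right_minus_eq)
  then show False
    using norm_mult_less[of "cnj b" 1 z 1] assms by simp
qed

lemma one_minus_norm_square_nonzero:
  fixes b :: complex
  assumes "norm b < 1"
  shows "1 - cnj b * b \<noteq> 0"
  using moebius_denominator_nonzero[OF assms assms] .

text \<open>The fixed point equation is quadratic (or has the root \<open>0\<close> when \<open>b = 0\<close>).\<close>

lemma moebius_has_fixed_point:
  fixes \<alpha> b :: complex
  assumes \<alpha>: "\<alpha> \<noteq> 0" and b: "norm b < 1"
  obtains p where "1 - cnj b * p \<noteq> 0" "\<alpha> * (p - b) = p * (1 - cnj b * p)"
proof -
  have "\<exists>p. \<alpha> * (p - b) = p * (1 - cnj b * p)"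
  proof (cases "b = 0")
    case True
    then show ?thesis by (intro exI[of _ 0]) simp
  next
    case False
    define s where "s = csqrt ((\<alpha> - 1)\<^sup>2 + 4 * \<alpha> * b * cnj b)"
    define p where "p = (1 - \<alpha> + s) / (2 * cnj b)"
    have s: "s\<^sup>2 = (\<alpha> - 1)\<^sup>2 + 4 * \<alpha> * b * cnj b" by (simp add: s_def)
    have "2 * cnj b * p = 1 - \<alpha> + s" using False by (simp add: p_def)
    then have "(2 * cnj b * p - (1 - \<alpha>))\<^sup>2 = (\<alpha> - 1)\<^sup>2 + 4 * \<alpha> * b * cnj b"
      using s by simp
    then have "4 * cnj b * (\<alpha> * (p - b)) = 4 * cnj b * (p * (1 - cnj b * p))"
      by (simp add: power2_eq_square algebra_simps)
    then show ?thesis using False by (intro exI[of _ p]) simp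
  qed
  then obtain p where p: "\<alpha> * (p - b) = p * (1 - cnj b * p)" by blast
  moreover have "1 - cnj b * p \<noteq> 0"
  proof
    assume 0: "1 - cnj b * p = 0"
    then have "p = b" using p \<alpha> by simp
    then show False using 0 one_minus_norm_square_nonzero[OF b] by simp
  qed
  ultimately show ?thesis using that by blast
qed

section \<open>The Abel equation\<close>

text \<open>The chain rule gives \<open>f' exp(f) = 0\<close>, hence \<open>f' = 0\<close>.\<close>

lemma constant_if_exp_constant:
  assumes f: "f holomorphic_on unit_disc" and c: "\<And>z. z \<in> unit_disc \<Longrightarrow> exp (f z) = c"
    and xy: "x \<in> unit_disc" "y \<in> unit_disc"
  shows "f x = f y"
proof -
  have "(f has_field_derivative 0) (at z within unit_disc)" if z: "z \<in> unit_disc" for z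
  proof -
    have df: "(f has_field_derivative deriv f z) (at z)"
      using holomorphic_derivI[OF f open_ball z] .
    then have "((\<lambda>z. exp (f z)) has_field_derivative exp (f z) * deriv f z) (at z)"
      by (rule DERIV_chain2[OF DERIV_exp])
    then have "((\<lambda>_. c) has_field_derivative exp (f z) * deriv f z) (at z)"
      by (rule has_field_derivative_transform_within_open[OF _ open_ball z]) (rule c)
    then have "exp (f z) * deriv f z = 0" using DERIV_const DERIV_unique by blast
    then have "deriv f z = 0" by simp
    then show ?thesis using df has_field_derivative_at_within by metis
  qed
  then have "\<exists>k. \<forall>z\<in>unit_disc. f z = k"
    by (intro has_field_derivative_zero_constant) auto
  then show ?thesis using xy by metis
qed

text \<open>
  Sending the fixed point \<open>p\<close> to infinity by \<open>L(z) = 1/(p - z)\<close> turns \<open>\<phi>\<close> into an affine map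
  \<open>L \<mapsto> A L + B\<close>.  For \<open>A = 1\<close> the coordinate \<open>L\<close> itself satisfies the Abel equation.  For
  \<open>A \<noteq> 1\<close> the affine map fixes \<open>q = B/(1 - A)\<close>; if \<open>L\<close> omits \<open>q\<close> on the disc then \<open>log (L - q)\<close>
  exists there and increases by a constant logarithm of \<open>A\<close>.
\<close>

lemma fixed_point_free_moebius_abel:
  assumes \<alpha>: "\<alpha> \<noteq> 0" and b: "norm b < 1"
    and \<phi>: "\<And>z. z \<in> unit_disc \<Longrightarrow> \<phi> z = \<alpha> * (z - b) / (1 - cnj b * z)"
    and hol: "\<phi> holomorphic_on unit_disc" and into: "\<phi> ` unit_disc \<subseteq> unit_disc"
    and nofix: "\<And>z. z \<in> unit_disc \<Longrightarrow> \<phi> z \<noteq> z"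
  obtains h \<kappa> where "h holomorphic_on unit_disc" "\<kappa> \<noteq> 0"
    "\<And>z. z \<in> unit_disc \<Longrightarrow> h (\<phi> z) = h z + \<kappa>"
proof -
  obtain p where p: "1 - cnj b * p \<noteq> 0" "\<alpha> * (p - b) = p * (1 - cnj b * p)"
    using moebius_has_fixed_point[OF \<alpha> b] .
  have into': "\<phi> z \<in> unit_disc" if "z \<in> unit_disc" for z using into that by blast
  have "p \<notin> unit_disc"
    using nofix[of p] \<phi>[of p] p by auto
  then have ne: "p - z \<noteq> 0" if "z \<in> unit_disc" for z using that by auto
  define L where "L z = 1 / (p - z)" for z
  have L: "L holomorphic_on unit_disc"
    unfolding L_def by (intro holomorphic_intros ne)
  have L_inj: "x = y" if "x \<in> unit_disc" "y \<in> unit_disc" "L x = L y" for x y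
    using that ne by (simp add: L_def)
  define d where "d = \<alpha> * (1 - cnj b * b)"
  have d: "d \<noteq> 0" using \<alpha> one_minus_norm_square_nonzero[OF b] by (simp add: d_def)
  define A where "A = (1 - cnj b * p)\<^sup>2 / d"
  define B where "B = (1 - cnj b * p) * cnj b / d"
  have A: "A \<noteq> 0" using p d by (simp add: A_def)
  have affine: "L (\<phi> z) = A * L z + B" if z: "z \<in> unit_disc" for z
  proof -
    have den: "1 - cnj b * z \<noteq> 0" using moebius_denominator_nonzero[of b z] b z by simp
    define X where "X = 1 - cnj b * p"
    define Y where "Y = 1 - cnj b * z"
    have X: "X \<noteq> 0" and Y: "Y \<noteq> 0" using p(1) den by (auto simp: X_def Y_def)
    (* The fixed point equation reads \<alpha> (p - b) = p X; it makes the numerator of p - \<phi> z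
       divisible by p - z, which is why L o \<phi> is affine in L. *)
    have "X * (Y * p - \<alpha> * (z - b)) = (p * X) * Y - \<alpha> * (z - b) * X"
      by (simp add: algebra_simps)
    also have "\<dots> = \<alpha> * (p - b) * Y - \<alpha> * (z - b) * X"
      using p(2) by (simp add: X_def)
    also have "\<dots> = d * (p - z)"
      by (simp add: X_def Y_def d_def algebra_simps)
    finally have "Y * p - \<alpha> * (z - b) = d * (p - z) / X"
      using X by (simp add: nonzero_eq_divide_eq mult.commute)
    moreover have "p - \<phi> z = (Y * p - \<alpha> * (z - b)) / Y"
      using Y by (simp add: \<phi>[OF z] diff_divide_distrib flip: Y_def)
    ultimately have "p - \<phi> z = d * (p - z) / (X * Y)" by simp
    then have "L (\<phi> z) = X * Y / (d * (p - z))" by (simp add: L_def)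
    also have "Y = X + cnj b * (p - z)" by (simp add: X_def Y_def algebra_simps)
    also have "X * (X + cnj b * (p - z)) / (d * (p - z)) = A * L z + B"
      using ne[OF z] d unfolding A_def B_def L_def X_def[symmetric]
      by (simp add: field_simps power2_eq_square)
    finally show ?thesis .
  qed
  have zero_in: "0 \<in> unit_disc" by simp
  show ?thesis
  proof (cases "A = 1")
    case True
    have "B \<noteq> 0"
      using affine[OF zero_in] True nofix[OF zero_in] L_inj[OF into'[OF zero_in] zero_in] by auto
    then show ?thesis using that[OF L, of B] affine True by simp
  next
    case False
    define q where "q = B / (1 - A)"
    have q: "L (\<phi> z) - q = A * (L z - q)" if "z \<in> unit_disc" for z
      using affine[OF that] False by (simp add: q_def field_simps)
    have "L z - q \<noteq> 0" if "z \<in> unit_disc" for z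
      using q[OF that] nofix[OF that] L_inj[OF into'[OF that] that] by auto
    moreover have "(\<lambda>z. L z - q) holomorphic_on unit_disc" by (intro holomorphic_intros L)
    ultimately obtain h where h: "h holomorphic_on unit_disc"
      and exp_h: "\<And>z. z \<in> unit_disc \<Longrightarrow> L z - q = exp (h z)"
      using contractible_imp_holomorphic_log[of "\<lambda>z. L z - q" unit_disc]
        convex_imp_contractible[OF convex_ball] by metis
    define \<kappa> where "\<kappa> = h (\<phi> 0) - h 0"
    have exp_diff_h: "exp (h (\<phi> z) - h z) = A" if "z \<in> unit_disc" for z
      using q[OF that] exp_h[OF that] exp_h[OF into'[OF that]] by (simp add: exp_diff)
    have "(\<lambda>z. h (\<phi> z) - h z) holomorphic_on unit_disc"
      using holomorphic_on_compose_gen[OF hol h into] h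
      by (auto simp: o_def intro!: holomorphic_intros)
    then have "h (\<phi> z) = h z + \<kappa>" if "z \<in> unit_disc" for z
      using constant_if_exp_constant[OF _ exp_diff_h that zero_in] by (simp add: \<kappa>_def algebra_simps)
    moreover have "\<kappa> \<noteq> 0"
      using exp_diff_h[OF zero_in] False by (auto simp: \<kappa>_def)
    ultimately show ?thesis using that[OF h] by blast
  qed
qed

section \<open>A function with backward invariant zero set\<close>

lemma automorphism_backward_invariant_zeros:
  assumes hol: "\<phi> holomorphic_on unit_disc" and inj: "inj_on \<phi> unit_disc"
    and onto: "\<phi> ` unit_disc = unit_disc"
  obtains g a where "g \<in> hol_disc" "g \<noteq> 0" "a \<in> unit_disc" "g a = 0"
    "\<And>z. z \<in> unit_disc \<Longrightarrow> g (\<phi> z) = 0 \<Longrightarrow> g z = 0"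
proof -
  note conclude = that
  have into': "\<phi> z \<in> unit_disc" if "z \<in> unit_disc" for z using onto that by blast
  (* \<phi> maps the disc into itself, so extension by 0 outside the disc preserves the backward
     invariance of the zeros. *)
  have restrict: thesis if "g holomorphic_on unit_disc" "c \<in> unit_disc" "g c \<noteq> 0" "a \<in> unit_disc" "g a = 0"
    "\<And>z. z \<in> unit_disc \<Longrightarrow> g (\<phi> z) = 0 \<Longrightarrow> g z = 0" for g a c
  proof (rule conclude[of "\<lambda>z. if z \<in> unit_disc then g z else 0" a])
    let ?g = "\<lambda>z. if z \<in> unit_disc then g z else 0"
    show "?g \<in> hol_disc" using hol_disc_restrict that(1) .
    show "?g \<noteq> 0" using that(2,3) by (auto simp: fun_eq_iff)
    show "?g z = 0" if "z \<in> unit_disc" "?g (\<phi> z) = 0" for z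
      using that into'[OF that(1)] \<open>\<And>z. z \<in> unit_disc \<Longrightarrow> g (\<phi> z) = 0 \<Longrightarrow> g z = 0\<close> by simp
  qed (use that in auto)
  show thesis
  proof (cases "\<exists>p\<in>unit_disc. \<phi> p = p")
    case True
    then obtain p where p: "p \<in> unit_disc" "\<phi> p = p" by blast
    have "\<exists>c\<in>unit_disc. c \<noteq> p" by (cases "p = 0") (auto intro: bexI[of _ "1/2"] bexI[of _ 0])
    then obtain c where c: "c \<in> unit_disc" "c \<noteq> p" by blast
    show thesis
    proof (rule restrict)
      show "(\<lambda>z. z - p) holomorphic_on unit_disc" by (intro holomorphic_intros)
      show "z - p = 0" if "z \<in> unit_disc" "\<phi> z - p = 0" for z
        using inj_onD[OF inj, of z p] that p by simp
    qed (use p c in auto)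
  next
    case False
    obtain \<alpha> b where \<alpha>b: "\<alpha> \<noteq> 0" "norm b < 1"
      "\<And>z. z \<in> unit_disc \<Longrightarrow> \<phi> z = \<alpha> * (z - b) / (1 - cnj b * z)"
      by (rule disc_automorphism_is_moebius[OF hol inj onto]) (rule that)
    have nofix: "\<phi> z \<noteq> z" if "z \<in> unit_disc" for z using False that by blast
    obtain h \<kappa> where h: "h holomorphic_on unit_disc" "\<kappa> \<noteq> 0"
      "\<And>z. z \<in> unit_disc \<Longrightarrow> h (\<phi> z) = h z + \<kappa>"
      by (rule fixed_point_free_moebius_abel[OF \<alpha>b hol equalityD1[OF onto] nofix])
        (assumption+, rule that)
    (* With this scaling k o \<phi> = k + 2 \<pi> i, so exp k is \<phi>-invariant; k itself is not, so exp k
       is not constant. *)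
    define k where "k z = 2 * of_real pi * \<i> * h z / \<kappa>" for z
    have k: "k holomorphic_on unit_disc"
      unfolding k_def using h(2) by (intro holomorphic_intros h(1)) auto
    have k_shift: "k (\<phi> z) = k z + 2 * of_real pi * \<i>" if "z \<in> unit_disc" for z
      using h(2) h(3)[OF that] by (simp add: k_def field_simps)
    have "\<exists>c\<in>unit_disc. exp (k c) \<noteq> exp (k 0)"
    proof (rule ccontr)
      assume "\<not> (\<exists>c\<in>unit_disc. exp (k c) \<noteq> exp (k 0))"
      then have const: "exp (k z) = exp (k 0)" if "z \<in> unit_disc" for z using that by blast
      have "k (\<phi> 0) = k 0"
        by (rule constant_if_exp_constant[OF k const into']) simp_all
      then show False using k_shift[of 0] by simp
    qed
    then obtain c where c: "c \<in> unit_disc" "exp (k c) \<noteq> exp (k 0)" by blast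
    show thesis
    proof (rule restrict)
      show "(\<lambda>z. exp (k z) - exp (k 0)) holomorphic_on unit_disc" by (intro holomorphic_intros k)
      show "exp (k z) - exp (k 0) = 0" if "z \<in> unit_disc" "exp (k (\<phi> z)) - exp (k 0) = 0" for z
        using that k_shift[OF that(1)] by (simp add: exp_add)
      show "exp (k c) - exp (k 0) \<noteq> 0" "c \<in> unit_disc" using c by simp_all
      show "exp (k 0) - exp (k 0) = 0" "(0::complex) \<in> unit_disc" by simp_all
    qed
  qed
qed

text \<open>
  Starting from \<open>u(a) \<noteq> 0\<close> and pulling \<open>a\<close> back along \<open>\<phi>\<close>, each application of the operator
  leads to a zero of \<open>g\<close> at which the image of \<open>u\<close> does not vanish.
\<close>

lemma not_strongly_supercyclic_of_zeros:
  assumes nz: "\<And>z. z \<in> unit_disc \<Longrightarrow> w z \<noteq> 0" and onto: "\<phi> ` unit_disc = unit_disc"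
    and g: "g \<in> hol_disc" "g \<noteq> 0" and a: "a \<in> unit_disc" "g a = 0"
    and pull: "\<And>z. z \<in> unit_disc \<Longrightarrow> g (\<phi> z) = 0 \<Longrightarrow> g z = 0"
  shows "\<not> strongly_supercyclic compact_open_disc fun_scale (weighted_comp w \<phi>)"
proof
  let ?T = "weighted_comp w \<phi>"
  assume ssc: "strongly_supercyclic compact_open_disc fun_scale ?T"
  define U where "U = {f \<in> hol_disc. f a \<in> - {0}}"
  have U_open: "openin compact_open_disc U"
    unfolding U_def using a(1) by (intro openin_compact_open_disc_eval) auto
  have "(\<lambda>z. if z \<in> unit_disc then 1 else 0) \<in> U"
    using a(1) hol_disc_restrict[of "\<lambda>_. 1"] by (simp add: U_def)
  then have "U \<noteq> {}" by blast
  obtain c n u where u: "u \<in> U" and gu: "g = fun_scale c ((?T ^^ n) u)"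
    by (rule strongly_supercyclicE[OF ssc U_open \<open>U \<noteq> {}\<close> g])
  have "\<exists>z\<in>unit_disc. g z = 0 \<and> (?T ^^ n) u z \<noteq> 0"
  proof (induction n)
    case 0
    then show ?case using u a by (auto simp: U_def)
  next
    case (Suc n)
    then obtain z where z: "z \<in> unit_disc" "g z = 0" "(?T ^^ n) u z \<noteq> 0" by blast
    from z(1) have "z \<in> \<phi> ` unit_disc" by (simp only: onto)
    then obtain y where y: "y \<in> unit_disc" "\<phi> y = z" by blast
    have "(?T ^^ Suc n) u y = w y * (?T ^^ n) u z"
      using y by (simp add: weighted_comp_def)
    then have "(?T ^^ Suc n) u y \<noteq> 0" using z(3) nz[OF y(1)] by simp
    moreover have "g y = 0" using pull[OF y(1)] y(2) z(2) by simp
    ultimately show ?case using y(1) by blast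
  qed
  then obtain z where z: "g z = 0" "(?T ^^ n) u z \<noteq> 0" by blast
  have g_eq: "g x = c * (?T ^^ n) u x" for x
    using fun_cong[OF gu, of x] by (simp only: fun_scale_def)
  have "c = 0" using g_eq[of z] z by simp
  then have "g = 0" using g_eq by (simp add: fun_eq_iff)
  then show False using g(2) by contradiction
qed

theorem theorem2p1:
  fixes w \<phi> :: "complex \<Rightarrow> complex"
  assumes "w holomorphic_on unit_disc"
    and "\<phi> holomorphic_on unit_disc"
    and "\<phi> ` unit_disc \<subseteq> unit_disc"
  shows "\<not> strongly_supercyclic compact_open_disc fun_scale (weighted_comp w \<phi>)"
proof
  assume ssc: "strongly_supercyclic compact_open_disc fun_scale (weighted_comp w \<phi>)"
  note aut = strongly_supercyclic_imp_automorphism[OF ssc assms]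
  obtain g a where g: "g \<in> hol_disc" "g \<noteq> 0" "a \<in> unit_disc" "g a = 0"
    "\<And>z. z \<in> unit_disc \<Longrightarrow> g (\<phi> z) = 0 \<Longrightarrow> g z = 0"
    by (rule automorphism_backward_invariant_zeros[OF assms(2) aut(2,3)]) (rule that)
  have "\<not> strongly_supercyclic compact_open_disc fun_scale (weighted_comp w \<phi>)"
    by (rule not_strongly_supercyclic_of_zeros[OF aut(1,3) g])
  then show False using ssc ..
qed

end
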